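(* Let $q\ge 10$ be an integer with $q\equiv 2$ or $q\equiv 3 \pmod 4$, and let $\ell=\binom{q}{2}$. For every integer $k\ge 1$ and $n=(\ell+1)^k$, there exists a completely balanced edge-coloring of $K_n$ with $\ell$ colors that contains no rainbow $K_q$; that is, $d(n,K_q)=\infty$.
   Context: $K_n$ denotes the complete graph on $n$ vertices. An edge-coloring of $K_n$ using a set $C$ of $\ell$ colors, where $\ell$ divides $n-1$, is completely balanced if every vertex is incident to exactly $(n-1)/\ell$ edges of each color of $C$. A subgraph is rainbow if all its edges receive distinct colors. An $(\ell,d)$-coloring of $K_n$ is an edge-coloring using exactly $\ell$ colors in total such that every vertex is incident to at least $d$ edges of every color. For a graph $F$ with $\ell$ edges, $d(n,F)=\infty$ if $K_n$ has an $(\ell,\lfloor (n-1)/\ell\rfloor)$-coloring without a rainbow copy of $F$; otherwise $d(n,F)$ is the smallest integer $d$ such that every $(\ell,d)$-coloring of $K_n$ contains a rainbow copy of $F$. *)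

theory Defs
  imports Complex_Main "HOL-Library.Extended_Nat"
begin

text \<open>
  A graph is a pair of a vertex set and a set of edges, each edge being a two-element set of
  vertices. An edge-coloring is a function on edges; its values outside the edge set are irrelevant.
\<close>

type_synonym 'a graph = "'a set \<times> 'a set set"

abbreviation verts :: "'a graph \<Rightarrow> 'a set" where
  "verts G \<equiv> fst G"

abbreviation edges :: "'a graph \<Rightarrow> 'a set set" where
  "edges G \<equiv> snd G"

definition is_graph :: "'a graph \<Rightarrow> bool" where
  "is_graph G \<longleftrightarrow> finite (verts G) \<and> (\<forall>e \<in> edges G. e \<subseteq> verts G \<and> card e = 2)"

definition complete_graph :: "nat \<Rightarrow> nat graph" where
  "complete_graph n = ({..<n}, {e. e \<subseteq> {..<n} \<and> card e = 2})"

definition is_subgraph :: "'a graph \<Rightarrow> 'a graph \<Rightarrow> bool" where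
  "is_subgraph H G \<longleftrightarrow> is_graph H \<and> verts H \<subseteq> verts G \<and> edges H \<subseteq> edges G"

definition isomorphic :: "'a graph \<Rightarrow> 'b graph \<Rightarrow> bool" where
  "isomorphic F H \<longleftrightarrow> (\<exists>f. bij_betw f (verts F) (verts H) \<and> (\<lambda>e. f ` e) ` edges F = edges H)"

definition rainbow :: "('a set \<Rightarrow> 'c) \<Rightarrow> 'a graph \<Rightarrow> bool" where
  "rainbow c H \<longleftrightarrow> inj_on c (edges H)"

definition has_rainbow_copy :: "'a graph \<Rightarrow> ('a set \<Rightarrow> 'c) \<Rightarrow> 'b graph \<Rightarrow> bool" where
  "has_rainbow_copy G c F \<longleftrightarrow> (\<exists>H. is_subgraph H G \<and> isomorphic F H \<and> rainbow c H)"

definition color_degree :: "'a graph \<Rightarrow> ('a set \<Rightarrow> 'c) \<Rightarrow> 'a \<Rightarrow> 'c \<Rightarrow> nat" where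
  "color_degree G c v a = card {e \<in> edges G. v \<in> e \<and> c e = a}"

definition completely_balanced :: "nat \<Rightarrow> 'c set \<Rightarrow> (nat set \<Rightarrow> 'c) \<Rightarrow> bool" where
  "completely_balanced n C c \<longleftrightarrow>
     finite C \<and> card C dvd n - 1 \<and>
     (\<forall>e \<in> edges (complete_graph n). c e \<in> C) \<and>
     (\<forall>v \<in> verts (complete_graph n). \<forall>a \<in> C.
        color_degree (complete_graph n) c v a = (n - 1) div card C)"

definition min_degree_coloring :: "nat \<Rightarrow> nat \<Rightarrow> nat \<Rightarrow> (nat set \<Rightarrow> 'c) \<Rightarrow> bool" where
  "min_degree_coloring n l d c \<longleftrightarrow>
     finite (c ` edges (complete_graph n)) \<and>
     card (c ` edges (complete_graph n)) = l \<and>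
     (\<forall>v \<in> verts (complete_graph n). \<forall>a \<in> c ` edges (complete_graph n).
        color_degree (complete_graph n) c v a \<ge> d)"

text \<open>
  Colors range over the natural numbers, which loses no generality because only finitely many
  are used. In the second case the minimum is over a nonempty set, as it contains
  \<open>(n - 1) div card (edges F)\<close>.
\<close>

definition rainbow_degree :: "nat \<Rightarrow> 'b graph \<Rightarrow> enat" where
  "rainbow_degree n F =
     (if \<exists>c :: nat set \<Rightarrow> nat.
           min_degree_coloring n (card (edges F)) ((n - 1) div card (edges F)) c \<and>
           \<not> has_rainbow_copy (complete_graph n) c F
      then \<infinity>
      else enat (LEAST d. \<forall>c :: nat set \<Rightarrow> nat.
             min_degree_coloring n (card (edges F)) d c \<longrightarrow>
             has_rainbow_copy (complete_graph n) c F))"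

end

theory Submission
  imports Defs "HOL-Number_Theory.Cong"
begin

text \<open>
  For \<open>k = 1\<close>, color the complete graph on \<open>\<int>\<^sub>l \<union> {\<infinity>}\<close> by \<open>i + j\<close> on the edge \<open>{i, j}\<close> and
  by \<open>2 i\<close> on the edge \<open>{i, \<infinity>}\<close>. Since \<open>l\<close> is odd, every color class is a perfect matching.
  The finite vertices of a rainbow clique form a set \<open>T \<subseteq> \<int>\<^sub>l\<close> whose pairs have distinct sums.
  If two pairs \<open>(a, b)\<close> and \<open>(c, d)\<close> have equal differences, then \<open>a + d = b + c\<close>, so one of the
  pairs can be prolonged to a three-term progression in \<open>T\<close>. Every element of \<open>T\<close> is the midpoint
  of at most one such progression, so \<open>t (t - 1) - 2 t \<le> l - 1\<close> for \<open>t = |T|\<close>, which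
  contradicts \<open>t \<ge> q - 1\<close> and \<open>l = q (q - 1) / 2\<close>. For larger \<open>k\<close> the coloring is iterated
  inside blocks. A rainbow clique with two vertices in one block and a third one outside has two
  edges of the same color, so it lies in a single block or meets every block at most once.
\<close>

section \<open>Rainbow vertex sets and regular colorings\<close>

text \<open>Cliques are treated as vertex sets; \<open>rainbow_copy_complete_graph\<close> reduces
  copies of \<open>complete_graph q\<close> to this form.\<close>

definition rainbow_set :: "('a set \<Rightarrow> 'c) \<Rightarrow> 'a set \<Rightarrow> bool" where
  "rainbow_set c S \<longleftrightarrow> inj_on c {e. e \<subseteq> S \<and> card e = 2}"

text \<open>Neighbors are counted instead of edges, so that degrees reduce to arithmetic on
  vertices; \<open>color_degree_complete_graph\<close> translates back.\<close>

definition regular_coloring :: "nat \<Rightarrow> nat \<Rightarrow> nat \<Rightarrow> (nat set \<Rightarrow> nat) \<Rightarrow> bool" where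
  "regular_coloring n l d c \<longleftrightarrow>
     (\<forall>u<n. \<forall>v<n. u \<noteq> v \<longrightarrow> c {u, v} < l) \<and>
     (\<forall>v<n. \<forall>a<l. card {u. u < n \<and> u \<noteq> v \<and> c {u, v} = a} = d)"

lemma rainbow_setD:
  assumes "rainbow_set c S" "{a, b, x, y} \<subseteq> S" "a \<noteq> b" "x \<noteq> y" "c {a, b} = c {x, y}"
  shows "{a, b} = {x, y}"
  using assms unfolding rainbow_set_def by (auto dest: inj_onD[of c _ "{a, b}" "{x, y}"])

lemma rainbow_setI:
  assumes "\<And>a b x y. {a, b, x, y} \<subseteq> S \<Longrightarrow> a \<noteq> b \<Longrightarrow> x \<noteq> y \<Longrightarrow> c {a, b} = c {x, y} \<Longrightarrow> {a, b} = {x, y}"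
  shows "rainbow_set c S"
  unfolding rainbow_set_def
proof (rule inj_onI)
  fix e f
  assume *: "e \<in> {e. e \<subseteq> S \<and> card e = 2}" "f \<in> {e. e \<subseteq> S \<and> card e = 2}" "c e = c f"
  then obtain a b x y where "e = {a, b}" "a \<noteq> b" "f = {x, y}" "x \<noteq> y"
    by (auto simp: card_2_iff)
  with * assms[of a b x y] show "e = f" by auto
qed

lemma rainbow_set_image:
  assumes "rainbow_set c S" "inj_on f S" and "\<And>x y. x \<in> S \<Longrightarrow> y \<in> S \<Longrightarrow> x \<noteq> y \<Longrightarrow> c {x, y} = c' {f x, f y}"
  shows "rainbow_set c' (f ` S)"
proof (rule rainbow_setI)
  fix a b x y
  assume *: "{a, b, x, y} \<subseteq> f ` S" "a \<noteq> b" "x \<noteq> y" "c' {a, b} = c' {x, y}"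
  then obtain a' b' x' y' where pre: "{a', b', x', y'} \<subseteq> S" "a = f a'" "b = f b'" "x = f x'" "y = f y'"
    by auto
  with * have ne: "a' \<noteq> b'" "x' \<noteq> y'" by auto
  have "c {a', b'} = c {x', y'}"
    using assms(3)[of a' b'] assms(3)[of x' y'] pre ne * by auto
  from rainbow_setD[OF assms(1) pre(1) ne this] show "{a, b} = {x, y}"
    by (auto simp: pre doubleton_eq_iff)
qed

section \<open>Sets with distinct pair sums modulo an odd number\<close>

lemma double_cong_imp_eq:
  fixes l :: int
  assumes "odd l" "a \<in> {0..<l}" "b \<in> {0..<l}" "[a + a = b + b] (mod l)"
  shows "a = b"
proof -
  have "[2 * a = 2 * b] (mod l)" using assms(4) by (simp only: mult_2)
  moreover have "coprime 2 l" using assms(1) by simp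
  ultimately have "[a = b] (mod l)" by (simp add: cong_mult_lcancel)
  then show ?thesis using assms by (simp add: cong_def)
qed

text \<open>Only pairs of distinct elements are assumed to have distinct sums, so
  \<open>a + c = b + b\<close> can still occur. These progressions cost the term
  \<open>2 * card T\<close>; the remaining ordered pairs have distinct nonzero differences modulo
  \<open>l\<close>, which gives \<open>l - 1\<close>.\<close>

lemma weak_Sidon_bound:
  fixes T :: "int set" and l :: int
  assumes l: "odd l" "l > 0" and T: "T \<subseteq> {0..<l}"
    and sums: "\<And>a b x y. {a, b, x, y} \<subseteq> T \<Longrightarrow> a \<noteq> b \<Longrightarrow> x \<noteq> y \<Longrightarrow>
      [a + b = x + y] (mod l) \<Longrightarrow> {a, b} = {x, y}"
  shows "int (card T * (card T - 1)) \<le> int (2 * card T) + (l - 1)"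
proof -
  have fin: "finite T" using T finite_subset by blast
  have inject: "a = b" if "a \<in> T" "b \<in> T" "[a = b] (mod l)" for a b
  proof -
    have "a \<in> {0..<l}" "b \<in> {0..<l}" using that T by blast+
    then show ?thesis using that by (simp add: cong_def)
  qed
  \<comment> \<open>In a pair \<open>(b, a)\<close> the first entry is the candidate midpoint. The
    pair lies in \<open>B\<close> if the reflection \<open>2 * b - a\<close> of \<open>a\<close> in
    \<open>b\<close> is, modulo \<open>l\<close>, again in \<open>T\<close>; \<open>E b\<close>
    collects the ends of progressions with midpoint \<open>b\<close>.\<close>
  define P where "P = (SIGMA b:T. T - {b})"
  define E where "E b = {a \<in> T - {b}. \<exists>c\<in>T. [a + c = b + b] (mod l)}" for b
  define B where "B = (SIGMA b:T. E b)"
  have cardP: "card P = card T * (card T - 1)"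
    unfolding P_def using fin by simp
  have cardE: "card (E b) \<le> 2" if b: "b \<in> T" for b
  proof (cases "E b = {}")
    case False
    \<comment> \<open>Doubling is injective modulo the odd number \<open>l\<close>, so the two ends
      of a progression differ and \<open>sums\<close> applies to them.\<close>
    have ne: "a \<noteq> c" if "a \<in> T" "a \<noteq> b" "[a + c = b + b] (mod l)" for a c
    proof -
      have "a \<in> {0..<l}" "b \<in> {0..<l}" using that(1) b T by blast+
      then show ?thesis using double_cong_imp_eq[OF l(1), of a b] that by auto
    qed
    from False obtain a c where a: "a \<in> T" "a \<noteq> b" "c \<in> T" "[a + c = b + b] (mod l)"
      by (auto simp: E_def)
    have "E b \<subseteq> {a, c}"
    proof
      fix a' assume "a' \<in> E b"
      then obtain c' where a': "a' \<in> T" "a' \<noteq> b" "c' \<in> T" "[a' + c' = b + b] (mod l)"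
        by (auto simp: E_def)
      have "[a' + c' = a + c] (mod l)" using a(4) a'(4) cong_sym cong_trans by blast
      moreover have "a \<noteq> c" "a' \<noteq> c'" using ne a a' by blast+
      ultimately have "{a', c'} = {a, c}" using sums[of a' c' a c] a a' by blast
      then show "a' \<in> {a, c}" by auto
    qed
    then have "card (E b) \<le> card {a, c}" by (intro card_mono) auto
    also have "\<dots> \<le> 2" by (simp add: card_insert_if)
    finally show ?thesis .
  qed auto
  have "card B = (\<Sum>b\<in>T. card (E b))"
    unfolding B_def E_def using fin by (subst card_SigmaI) auto
  also have "\<dots> \<le> (\<Sum>b\<in>T. 2)" by (intro sum_mono cardE)
  finally have cardB: "card B \<le> 2 * card T" by simp
  have BP: "B \<subseteq> P" by (auto simp: B_def P_def E_def)
  \<comment> \<open>Equal differences give \<open>a + d = b + c\<close> modulo \<open>l\<close>. The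
    case \<open>a = d\<close> would put \<open>(d, c)\<close> into \<open>B\<close>, the case
    \<open>b = c\<close> would put \<open>(b, a)\<close> there; otherwise \<open>sums\<close>
    identifies the two pairs.\<close>
  have "inj_on (\<lambda>(b, a). (a - b) mod l) (P - B)"
  proof (rule inj_onI, clarify)
    fix a b c d
    assume ab: "(b, a) \<in> P" "(b, a) \<notin> B" and cd: "(d, c) \<in> P" "(d, c) \<notin> B"
      and "(a - b) mod l = (c - d) mod l"
    then have *: "[a - b = c - d] (mod l)" by (simp add: cong_def)
    have in_T: "a \<in> T" "b \<in> T" "c \<in> T" "d \<in> T" "a \<noteq> b" "c \<noteq> d" using ab cd by (auto simp: P_def)
    have sum: "[a + d = b + c] (mod l)"
      using cong_add[OF * cong_refl[of "b + d"]] by (simp add: algebra_simps)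
    have "a \<noteq> d"
    proof
      assume "a = d"
      then have "[c + b = d + d] (mod l)" using sum by (simp add: add.commute cong_sym)
      then show False using cd in_T by (auto simp: B_def E_def)
    qed
    moreover have "b \<noteq> c"
    proof
      assume "b = c"
      then have "[a + d = b + b] (mod l)" using sum by simp
      then show False using ab in_T by (auto simp: B_def E_def)
    qed
    ultimately have "{a, d} = {b, c}" using sums[of a d b c] sum in_T by blast
    then show "b = d \<and> a = c" using in_T by (auto simp: doubleton_eq_iff)
  qed
  moreover have "(\<lambda>(b, a). (a - b) mod l) ` (P - B) \<subseteq> {1..<l}"
  proof clarify
    fix a b assume "(b, a) \<in> P"
    then have "a \<in> T" "b \<in> T" "a \<noteq> b" by (auto simp: P_def)
    then have "(a - b) mod l \<noteq> 0"
      using inject[of a b] by (auto simp: cong_iff_dvd_diff)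
    moreover have "0 \<le> (a - b) mod l" "(a - b) mod l < l" using l by auto
    ultimately show "(a - b) mod l \<in> {1..<l}" by auto
  qed
  ultimately have "card (P - B) \<le> card {1..<l}"
    by (rule card_inj_on_le) simp
  moreover have "card P \<le> card (P - B) + card B"
    using card_Un_le[of "P - B" B] BP by (simp add: Un_absorb2)
  ultimately have "int (card P) \<le> (l - 1) + int (card B)" using l by auto
  with cardB cardP show ?thesis by linarith
qed

section \<open>A one-factorization of the complete graph on \<open>l + 1\<close> vertices\<close>

text \<open>The vertex \<open>l\<close> plays the role of \<open>\<infinity>\<close>.\<close>

definition factor_coloring :: "nat \<Rightarrow> nat set \<Rightarrow> nat" where
  "factor_coloring l e = (if l \<in> e then 2 * \<Sum>(e - {l}) else \<Sum>e) mod l"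

lemma factor_coloring_finite:
  "u < l \<Longrightarrow> v < l \<Longrightarrow> u \<noteq> v \<Longrightarrow> factor_coloring l {u, v} = (u + v) mod l"
  by (auto simp: factor_coloring_def)

lemma factor_coloring_infty:
  assumes "u < l"
  shows "factor_coloring l {u, l} = (u + u) mod l" "factor_coloring l {l, u} = (u + u) mod l"
proof -
  have "{u, l} - {l} = {u}" "{l, u} - {l} = {u}" using assms by auto
  then show "factor_coloring l {u, l} = (u + u) mod l" "factor_coloring l {l, u} = (u + u) mod l"
    by (simp_all add: factor_coloring_def mult_2)
qed

text \<open>Modulo \<open>l\<close>, the partner of a finite \<open>v\<close> in color
  \<open>a\<close> is \<open>a - v\<close>, or the vertex \<open>l\<close> in case this is
  \<open>v\<close> itself. The partner of the vertex \<open>l\<close> is half of \<open>a\<close>,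
  which exists and is unique because \<open>l\<close> is odd.\<close>

lemma regular_factor_coloring:
  assumes l: "odd l"
  shows "regular_coloring (l + 1) l 1 (factor_coloring l)"
proof -
  have l0: "l > 0" using odd_pos[of l] l by simp
  have dbl: "u = w" if "u < l" "w < l" "(u + u) mod l = (w + w) mod l" for u w
  proof -
    have "[int u + int u = int w + int w] (mod int l)"
      using that(3) by (simp only: cong_def flip: of_nat_add of_nat_mod)
    then show ?thesis using double_cong_imp_eq[of "int l" "int u" "int w"] that l by auto
  qed
  have can: "u = w" if "u < l" "w < l" "(u + v) mod l = (w + v) mod l" for u v w
  proof -
    have "[u + v = w + v] (mod l)" using that(3) by (simp add: cong_def)
    then have "[u = w] (mod l)" by (simp only: cong_add_rcancel_nat)
    then show ?thesis using that(1,2) by (rule cong_less_modulus_unique_nat)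
  qed
  have single: "\<exists>w. {u. u < l + 1 \<and> u \<noteq> v \<and> factor_coloring l {u, v} = a} = {w}"
    if "w < l + 1" "w \<noteq> v" "factor_coloring l {w, v} = a"
      "\<And>u. u < l + 1 \<Longrightarrow> u \<noteq> v \<Longrightarrow> factor_coloring l {u, v} = a \<Longrightarrow> u = w" for v a w
    using that by blast
  have ex: "\<exists>w. {u. u < l + 1 \<and> u \<noteq> v \<and> factor_coloring l {u, v} = a} = {w}"
    if v: "v < l + 1" and a: "a < l" for v a
  proof (cases "v = l")
    case True
    \<comment> \<open>Exactly one of \<open>a\<close> and \<open>a + l\<close> is even, so this is
      half of \<open>a\<close> modulo \<open>l\<close>.\<close>
    define w where "w = (if even a then a div 2 else (a + l) div 2)"
    have "w + w = (if even a then a else a + l)" using l by (auto simp: w_def elim!: evenE oddE)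
    then have w: "w < l" "(w + w) mod l = a" using a by (auto split: if_splits)
    show ?thesis
    proof (rule single[of w])
      show "w < l + 1" "w \<noteq> v" using w True by auto
      show "factor_coloring l {w, v} = a" using w True by (simp add: factor_coloring_infty)
      fix u assume "u < l + 1" "u \<noteq> v" and u: "factor_coloring l {u, v} = a"
      then have "u < l" using True by simp
      with u True have "(u + u) mod l = a" by (simp add: factor_coloring_infty)
      with \<open>u < l\<close> w show "u = w" using dbl[of u w] by simp
    qed
  next
    case False
    with v have v: "v < l" by simp
    \<comment> \<open>Here \<open>l - v\<close> represents \<open>- v\<close> modulo
      \<open>l\<close> without truncated subtraction.\<close>
    define w where "w = (a + (l - v)) mod l"
    have "(w + v) mod l = (a + (l - v) + v) mod l" by (simp add: w_def mod_add_left_eq)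
    then have w: "w < l" "(w + v) mod l = a" using v a l0 by (auto simp: w_def)
    have eq_w: "u = w" if "u < l" "u \<noteq> v" "factor_coloring l {u, v} = a" for u
    proof -
      have "(u + v) mod l = a" using that v factor_coloring_finite by auto
      then show ?thesis using that(1) w can[of u w v] by simp
    qed
    show ?thesis
    proof (cases "w = v")
      case True
      show ?thesis
      proof (rule single[of l])
        show "l < l + 1" "l \<noteq> v" using v by auto
        show "factor_coloring l {l, v} = a" using w True by (simp add: factor_coloring_infty)
        fix u assume "u < l + 1" "u \<noteq> v" "factor_coloring l {u, v} = a"
        with eq_w[of u] True show "u = l" by (cases "u < l") auto
      qed
    next
      case False
      show ?thesis
      proof (rule single[of w])
        show "w < l + 1" "w \<noteq> v" using w False by auto
        show "factor_coloring l {w, v} = a" using w v False by (simp add: factor_coloring_finite)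
        fix u assume u: "u < l + 1" "u \<noteq> v" "factor_coloring l {u, v} = a"
        have "u \<noteq> l"
        proof
          assume "u = l"
          then have "(v + v) mod l = a" using u(3) v by (simp add: factor_coloring_infty)
          then have "v = w" using v w can[of v w v] by simp
          with False show False by simp
        qed
        with u show "u = w" using eq_w[of u] by simp
      qed
    qed
  qed
  have "card {u. u < l + 1 \<and> u \<noteq> v \<and> factor_coloring l {u, v} = a} = 1"
    if "v < l + 1" "a < l" for v a
    using iffD2[OF card_1_singleton_iff ex[OF that]] by (simp only: One_nat_def)
  then show ?thesis unfolding regular_coloring_def using l0
    by (auto simp: factor_coloring_def)
qed

text \<open>Dropping the vertex \<open>l\<close> loses at most one element, and on the rest equal
  sums mean equal colors, so \<open>weak_Sidon_bound\<close> applies.\<close>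

lemma no_rainbow_factor_coloring:
  assumes l: "odd l" "l = q choose 2" and q: "q \<ge> 8"
    and S: "S \<subseteq> {..<l + 1}" "card S = q"
  shows "\<not> rainbow_set (factor_coloring l) S"
proof
  assume rb: "rainbow_set (factor_coloring l) S"
  define T where "T = S - {l}"
  have TS: "T \<subseteq> {..<l}" "T \<subseteq> S" using S by (auto simp: T_def less_Suc_eq)
  have card_T: "card (int ` T) = card T" by (simp add: card_image)
  have "finite S" using S finite_subset by blast
  then have t: "q \<le> card T + 1"
    using S(2) diff_card_le_card_Diff[of "{l}" S] by (simp add: T_def)
  have l0: "l > 0" using odd_pos[of l] l by simp
  have "int (card T * (card T - 1)) \<le> int (2 * card T) + (int l - 1)"
    unfolding card_T[symmetric]
  proof (rule weak_Sidon_bound)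
    show "odd (int l)" "int l > 0" "int ` T \<subseteq> {0..<int l}" using l l0 TS by auto
  next
    fix a b x y
    assume *: "{a, b, x, y} \<subseteq> int ` T" "a \<noteq> b" "x \<noteq> y" "[a + b = x + y] (mod int l)"
    then obtain a' b' x' y' where pre: "{a', b', x', y'} \<subseteq> T"
      "a = int a'" "b = int b'" "x = int x'" "y = int y'"
      by auto
    with * have ne: "a' \<noteq> b'" "x' \<noteq> y'" by auto
    have "[a' + b' = x' + y'] (mod l)"
      using * unfolding pre by (simp flip: cong_int_iff)
    then have "factor_coloring l {a', b'} = factor_coloring l {x', y'}"
      using pre ne TS by (subst (1 2) factor_coloring_finite) (auto simp: cong_def)
    with rainbow_setD[OF rb _ ne] pre TS have "{a', b'} = {x', y'}" by blast
    then show "{a, b} = {x, y}" by (auto simp: pre doubleton_eq_iff)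
  qed
  then have *: "int (card T) * (int (card T) - 1) \<le> 2 * int (card T) + (int l - 1)"
    using t q by (simp add: of_nat_diff)
  have "even (q * (q - 1))" by auto
  then have "2 * l = q * (q - 1)" unfolding l(2) choose_two by (rule dvd_mult_div_cancel)
  then have "int (2 * l) = int (q * (q - 1))" by simp
  then have l2: "2 * int l = int q * (int q - 1)" using q by (simp add: of_nat_diff)
  \<comment> \<open>With \<open>t = card T\<close> the bound reads
    \<open>t * (t - 3) \<le> l - 1\<close>, and its left side is smallest at
    \<open>t = q - 1\<close>.\<close>
  have "(int q - 1) * (int q - 4) \<le> int (card T) * (int (card T) - 3)"
    using t q by (intro mult_mono) auto
  then have "2 * ((int q - 1) * (int q - 4)) \<le> int q * (int q - 1) - 2"
    using * l2 by (simp add: algebra_simps)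
  \<comment> \<open>The left side is 2 at \<open>q = 8\<close> and at least 10 from
    \<open>q = 9\<close> on.\<close>
  then have "int q * (int q - 9) + 10 \<le> 0" by (simp add: algebra_simps)
  moreover have "int q * (int q - 9) \<ge> - 8"
  proof (cases "q = 8")
    case False
    with q have "int q * (int q - 9) \<ge> 0" by simp
    then show ?thesis by linarith
  qed simp
  ultimately show False by linarith
qed

section \<open>Blow-ups and iteration\<close>

text \<open>A vertex \<open>u\<close> encodes its block \<open>u div N\<close> and its position
  \<open>u mod N\<close> in the block. The cardinality test recognizes edges inside one block
  without naming their endpoints.\<close>

definition blowup_coloring :: "nat \<Rightarrow> (nat set \<Rightarrow> 'c) \<Rightarrow> (nat set \<Rightarrow> 'c) \<Rightarrow> nat set \<Rightarrow> 'c" where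
  "blowup_coloring N c c' e =
     (if card ((\<lambda>x. x div N) ` e) = 1 then c ((\<lambda>x. x mod N) ` e) else c' ((\<lambda>x. x div N) ` e))"

lemma blowup_coloring_pair:
  "blowup_coloring N c c' {u, v} =
     (if u div N = v div N then c {u mod N, v mod N} else c' {u div N, v div N})"
  by (auto simp: blowup_coloring_def)

lemma div_mod_eqI: "u div N = v div N \<Longrightarrow> u mod N = v mod N \<Longrightarrow> u = (v :: nat)"
  by (metis div_mult_mod_eq)

text \<open>In each color a vertex has \<open>d\<close> neighbors in its own block and is joined to
  all \<open>N\<close> vertices of each of \<open>d'\<close> other blocks.\<close>

lemma regular_blowup_coloring:
  assumes c: "regular_coloring N l d c" and c': "regular_coloring M l d' c'" and N: "N > 0"
  shows "regular_coloring (M * N) l (d' * N + d) (blowup_coloring N c c')"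
proof -
  have dm: "u div N < M" "u mod N < N" if "u < M * N" for u
    using that N by (auto simp: less_mult_imp_div_less)
  have "card {u. u < M * N \<and> u \<noteq> v \<and> blowup_coloring N c c' {u, v} = a} = d' * N + d"
    if v: "v < M * N" and a: "a < l" for v a
  proof -
    define A where "A = {u. u < N \<and> u \<noteq> v mod N \<and> c {u, v mod N} = a}"
    define A' where "A' = {u. u < M \<and> u \<noteq> v div N \<and> c' {u, v div N} = a}"
    \<comment> \<open>These are the block and position coordinates of the neighbors: whole blocks
      first, then positions in the block of \<open>v\<close>.\<close>
    define R where "R = A' \<times> {..<N} \<union> {v div N} \<times> A"
    have card_A: "card A = d" "card A' = d'"
      using c c' dm[OF v] a by (auto simp: A_def A'_def regular_coloring_def)
    have fin: "finite A" "finite A'" by (auto simp: A_def A'_def)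
    have less: "x * N + y < M * N" if "x < M" "y < N" for x y
    proof -
      have "x * N + y < (x + 1) * N" using that by simp
      also have "\<dots> \<le> M * N" using that by (intro mult_le_mono1) simp
      finally show ?thesis .
    qed
    have R: "x < M" "y < N" if "(x, y) \<in> R" for x y
      using that dm[OF v] by (auto simp: R_def A_def A'_def)
    have "bij_betw (\<lambda>(x, y). x * N + y) R {u. u < M * N \<and> u \<noteq> v \<and> blowup_coloring N c c' {u, v} = a}"
    proof (intro bij_betw_byWitness[where f' = "\<lambda>u. (u div N, u mod N)"] ballI image_subsetI)
      fix p assume p: "p \<in> R"
      obtain x y where xy: "p = (x, y)" by fastforce
      have "y < N" using R p xy by blast
      then have div_mod: "(x * N + y) div N = x" "(x * N + y) mod N = y" by simp_all
      show "((case p of (x, y) \<Rightarrow> x * N + y) div N, (case p of (x, y) \<Rightarrow> x * N + y) mod N) = p"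
        by (simp only: xy prod.case div_mod)
      have "x * N + y \<noteq> v" using p div_mod by (auto simp: xy R_def A_def A'_def)
      moreover have "blowup_coloring N c c' {x * N + y, v} = a"
        using p by (auto simp: blowup_coloring_pair div_mod xy R_def A_def A'_def)
      ultimately show "(case p of (x, y) \<Rightarrow> x * N + y) \<in> {u. u < M * N \<and> u \<noteq> v \<and> blowup_coloring N c c' {u, v} = a}"
        using less R[of x y] p xy by simp
    next
      fix u
      show "(case (u div N, u mod N) of (x, y) \<Rightarrow> x * N + y) = u" by simp
      assume "u \<in> {u. u < M * N \<and> u \<noteq> v \<and> blowup_coloring N c c' {u, v} = a}"
      then have "u < M * N" "u \<noteq> v" "blowup_coloring N c c' {u, v} = a" by auto
      with dm[of u] div_mod_eqI[of u N v] show "(u div N, u mod N) \<in> R"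
        by (auto simp: R_def A_def A'_def blowup_coloring_pair split: if_splits)
    qed
    then have "card {u. u < M * N \<and> u \<noteq> v \<and> blowup_coloring N c c' {u, v} = a} = card R"
      by (simp add: bij_betw_same_card)
    also have "\<dots> = card (A' \<times> {..<N}) + card ({v div N} \<times> A)"
      unfolding R_def using fin by (intro card_Un_disjoint) (auto simp: A'_def)
    finally show ?thesis using card_A by (simp add: card_cartesian_product)
  qed
  moreover have "blowup_coloring N c c' {u, v} < l" if "u < M * N" "v < M * N" "u \<noteq> v" for u v
    using dm[OF that(1)] dm[OF that(2)] that(3) c c' div_mod_eqI[of u N v]
    unfolding blowup_coloring_pair regular_coloring_def by presburger
  ultimately show ?thesis by (simp add: regular_coloring_def)
qed

text \<open>Injectivity is included so that the projected rainbow set keeps its size, as the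
  induction in \<open>iterated_coloring\<close> requires.\<close>

lemma rainbow_set_blowup_coloring:
  assumes rb: "rainbow_set (blowup_coloring N c c') S"
  shows "(inj_on (\<lambda>x. x mod N) S \<and> rainbow_set c ((\<lambda>x. x mod N) ` S)) \<or>
    (inj_on (\<lambda>x. x div N) S \<and> rainbow_set c' ((\<lambda>x. x div N) ` S))"
proof (cases "inj_on (\<lambda>x. x div N) S")
  case True
  then have "rainbow_set c' ((\<lambda>x. x div N) ` S)"
    by (intro rainbow_set_image[OF rb]) (auto simp: blowup_coloring_pair inj_on_def)
  with True show ?thesis by blast
next
  case False
  then obtain x y where xy: "x \<in> S" "y \<in> S" "x \<noteq> y" "x div N = y div N"
    by (auto simp: inj_on_def)
  have block: "z div N = x div N" if z: "z \<in> S" for z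
  proof (rule ccontr)
    assume *: "z div N \<noteq> x div N"
    \<comment> \<open>Both edges run between the same two blocks, so \<open>c'\<close> gives them
      one color.\<close>
    then have "blowup_coloring N c c' {x, z} = blowup_coloring N c c' {y, z}"
      using xy by (auto simp: blowup_coloring_pair)
    with rainbow_setD[OF rb, of x z y z] xy z * show False
      by (auto simp: doubleton_eq_iff)
  qed
  have inj: "inj_on (\<lambda>x. x mod N) S"
  proof (rule inj_onI)
    fix u v assume "u \<in> S" "v \<in> S" "u mod N = v mod N"
    with block[of u] block[of v] show "u = v" by (intro div_mod_eqI[of u N v]) simp_all
  qed
  then have "rainbow_set c ((\<lambda>x. x mod N) ` S)"
    by (intro rainbow_set_image[OF rb]) (auto simp: blowup_coloring_pair block)
  with inj show ?thesis by blast
qed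

text \<open>Each step replaces every vertex of the coloring for \<open>k\<close> by a block colored
  with \<open>c\<close>. The degree is described by a product, which avoids division in the
  induction.\<close>

lemma iterated_coloring:
  assumes c: "regular_coloring (l + 1) l 1 c" and q: "q \<ge> 2"
    and nr: "\<And>S. S \<subseteq> {..<l + 1} \<Longrightarrow> card S = q \<Longrightarrow> \<not> rainbow_set c S"
  shows "\<exists>d c'. l * d = (l + 1) ^ k - 1 \<and> regular_coloring ((l + 1) ^ k) l d c' \<and>
    (\<forall>S. S \<subseteq> {..<(l + 1) ^ k} \<longrightarrow> card S = q \<longrightarrow> \<not> rainbow_set c' S)"
proof (induction k)
  case 0
  \<comment> \<open>A single vertex contains no set of size \<open>q \<ge> 2\<close>, and any
    coloring has degree 0 there.\<close>
  have "card S \<noteq> q" if "S \<subseteq> {..<(l + 1) ^ 0}" for S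
    using card_mono[OF _ that] q by auto
  moreover have "regular_coloring ((l + 1) ^ 0) l 0 c"
    by (auto simp: regular_coloring_def)
  ultimately show ?case by (intro exI[of _ 0] exI[of _ c]) auto
next
  case (Suc k)
  then obtain d c' where d: "l * d = (l + 1) ^ k - 1" and c': "regular_coloring ((l + 1) ^ k) l d c'"
    and nr': "\<And>S. S \<subseteq> {..<(l + 1) ^ k} \<Longrightarrow> card S = q \<Longrightarrow> \<not> rainbow_set c' S"
    by blast
  have "l * d + 1 = (l + 1) ^ k" using d by simp
  then have "(l + 1) ^ Suc k = (l + 1) * (l * d + 1)" by simp
  then have "l * (d * (l + 1) + 1) = (l + 1) ^ Suc k - 1" by (simp add: algebra_simps)
  moreover have "regular_coloring ((l + 1) ^ Suc k) l (d * (l + 1) + 1) (blowup_coloring (l + 1) c c')"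
    using regular_blowup_coloring[OF c c'] by (simp add: mult.commute)
  moreover have "\<not> rainbow_set (blowup_coloring (l + 1) c c') S"
    if S: "S \<subseteq> {..<(l + 1) ^ Suc k}" "card S = q" for S
  proof
    assume "rainbow_set (blowup_coloring (l + 1) c c') S"
    from rainbow_set_blowup_coloring[OF this] show False
    proof (elim disjE conjE)
      assume "inj_on (\<lambda>x. x mod (l + 1)) S" "rainbow_set c ((\<lambda>x. x mod (l + 1)) ` S)"
      moreover have "(\<lambda>x. x mod (l + 1)) ` S \<subseteq> {..<l + 1}"
        by (intro image_subsetI) simp
      ultimately show False using nr[of "(\<lambda>x. x mod (l + 1)) ` S"] S(2) card_image by blast
    next
      have "x div (l + 1) < (l + 1) ^ k" if "x \<in> S" for x
        using S that by (intro less_mult_imp_div_less) (auto simp: mult.commute)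
      moreover assume "inj_on (\<lambda>x. x div (l + 1)) S" "rainbow_set c' ((\<lambda>x. x div (l + 1)) ` S)"
      ultimately show False using nr'[of "(\<lambda>x. x div (l + 1)) ` S"] S
        by (auto simp: card_image)
    qed
  qed
  ultimately show ?case by blast
qed

section \<open>Translation to graphs and the final assembly\<close>

lemma edges_complete_graph: "edges (complete_graph n) = {e. e \<subseteq> {..<n} \<and> card e = 2}"
  and verts_complete_graph: "verts (complete_graph n) = {..<n}"
  by (simp_all add: complete_graph_def)

lemma card_edges_complete_graph: "card (edges (complete_graph n)) = n choose 2"
  by (simp add: edges_complete_graph n_subsets)

lemma color_degree_complete_graph:
  assumes "v < n"
  shows "color_degree (complete_graph n) c v a = card {u. u < n \<and> u \<noteq> v \<and> c {u, v} = a}"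
proof -
  have "bij_betw (\<lambda>u. {u, v}) {u. u < n \<and> u \<noteq> v \<and> c {u, v} = a}
      {e \<in> edges (complete_graph n). v \<in> e \<and> c e = a}"
    unfolding bij_betw_def
  proof (intro conjI inj_onI equalityI subsetI)
    fix e assume e: "e \<in> {e \<in> edges (complete_graph n). v \<in> e \<and> c e = a}"
    then obtain x y where "e = {x, y}" "x \<noteq> y" by (auto simp: edges_complete_graph card_2_iff)
    with e obtain u where "e = {u, v}" "u \<noteq> v" by (cases "x = v") (auto simp: insert_commute)
    with e show "e \<in> (\<lambda>u. {u, v}) ` {u. u < n \<and> u \<noteq> v \<and> c {u, v} = a}"
      by (auto simp: edges_complete_graph)
  qed (use assms in \<open>auto simp: edges_complete_graph doubleton_eq_iff\<close>)
  then show ?thesis by (simp add: color_degree_def bij_betw_same_card)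
qed

lemma rainbow_copy_complete_graph:
  assumes "has_rainbow_copy (complete_graph n) c (complete_graph q)"
  shows "\<exists>S \<subseteq> {..<n}. card S = q \<and> rainbow_set c S"
proof -
  from assms obtain H f where H: "is_subgraph H (complete_graph n)" "rainbow c H"
    and f: "bij_betw f {..<q} (verts H)"
      "(\<lambda>e. f ` e) ` {e. e \<subseteq> {..<q} \<and> card e = 2} = edges H"
    by (auto simp: has_rainbow_copy_def isomorphic_def edges_complete_graph verts_complete_graph)
  \<comment> \<open>An isomorphism from a complete graph makes every pair of vertices of
    \<open>H\<close> an edge, so rainbowness of \<open>H\<close> covers all pairs.\<close>
  have "e \<in> edges H" if e: "e \<subseteq> verts H" "card e = 2" for e
  proof -
    from e(1) f(1) obtain e' where e': "e' \<subseteq> {..<q}" "e = f ` e'"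
      by (metis bij_betw_imp_surj_on subset_imageE)
    then have "card e' = 2"
      using e(2) f(1) by (metis bij_betw_def card_image inj_on_subset)
    with e' f(2) show ?thesis by blast
  qed
  then have "rainbow_set c (verts H)"
    using H(2) by (auto simp: rainbow_set_def rainbow_def intro: inj_on_subset)
  moreover have "card (verts H) = q" using bij_betw_same_card[OF f(1)] by simp
  ultimately show ?thesis
    using H(1) by (auto simp: is_subgraph_def verts_complete_graph)
qed

text \<open>The residue of \<open>q\<close> modulo 4 supplies the odd number of colors that the
  factor coloring requires.\<close>

lemma odd_choose_two:
  assumes "q mod 4 = 2 \<or> q mod 4 = 3"
  shows "odd (q choose 2)"
proof -
  define m where "m = q div 4"
  have "q = 4 * m + 2 \<or> q = 4 * m + 3" using assms unfolding m_def by presburger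
  then have "q * (q - 1) = 2 * ((2 * m + 1) * (4 * m + 1)) \<or>
      q * (q - 1) = 2 * ((4 * m + 3) * (2 * m + 1))"
    by (auto simp: algebra_simps)
  then have "q choose 2 = (2 * m + 1) * (4 * m + 1) \<or> q choose 2 = (4 * m + 3) * (2 * m + 1)"
    unfolding choose_two by (metis nonzero_mult_div_cancel_left zero_neq_numeral)
  then show ?thesis by auto
qed

theorem theorem2:
  fixes q l k n :: nat
  assumes "q \<ge> 10"
    and "q mod 4 = 2 \<or> q mod 4 = 3"
    and "l = q choose 2"
    and "k \<ge> 1"
    and "n = (l + 1) ^ k"
  shows "(\<exists>(C :: nat set) (c :: nat set \<Rightarrow> nat).
            card C = l \<and> completely_balanced n C c \<and>
            \<not> has_rainbow_copy (complete_graph n) c (complete_graph q))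
         \<and> rainbow_degree n (complete_graph q) = \<infinity>"
proof -
  have l: "odd l" using assms odd_choose_two by simp
  then have l0: "l > 0" by (cases l) auto
  obtain d c where d: "l * d = n - 1" and c: "regular_coloring n l d c"
    and nr: "\<And>S. S \<subseteq> {..<n} \<Longrightarrow> card S = q \<Longrightarrow> \<not> rainbow_set c S"
    using iterated_coloring[OF regular_factor_coloring[OF l], of q k]
      no_rainbow_factor_coloring[OF l assms(3)] assms(1) unfolding assms(5) by auto
  have no_copy: "\<not> has_rainbow_copy (complete_graph n) c (complete_graph q)"
    using nr rainbow_copy_complete_graph by blast
  have d_eq: "(n - 1) div l = d" using l0 unfolding d[symmetric] by simp
  \<comment> \<open>Since \<open>k \<ge> 1\<close>, the degree \<open>d\<close> is positive; hence
    every color below \<open>l\<close> occurs, already at vertex 0.\<close>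
  have "n > 1" using assms(4,5) l0 one_less_power[of "l + 1" k] by simp
  then have d0: "d > 0" using d by (cases d) auto
  have deg: "color_degree (complete_graph n) c v a = d" if "v < n" "a < l" for v a
    using c that by (simp add: color_degree_complete_graph regular_coloring_def)
  have in_range: "c e < l" if "e \<in> edges (complete_graph n)" for e
    using that c by (auto simp: edges_complete_graph card_2_iff regular_coloring_def)
  have image: "c ` edges (complete_graph n) = {..<l}"
  proof
    show "{..<l} \<subseteq> c ` edges (complete_graph n)"
    proof
      fix a assume "a \<in> {..<l}"
      then have "color_degree (complete_graph n) c 0 a > 0" using deg[of 0 a] d0 \<open>n > 1\<close> by simp
      then show "a \<in> c ` edges (complete_graph n)"
        by (auto simp: color_degree_def card_gt_0_iff)
    qed
  qed (use in_range in auto)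
  have "completely_balanced n {..<l} c"
    unfolding completely_balanced_def using in_range deg d_eq
    by (auto simp: verts_complete_graph d[symmetric] simp del: One_nat_def)
  \<comment> \<open>The same coloring witnesses the infinite case of \<open>rainbow_degree\<close>,
    as all its color degrees equal \<open>(n - 1) div l\<close>.\<close>
  moreover have "min_degree_coloring n (card (edges (complete_graph q)))
      ((n - 1) div card (edges (complete_graph q))) c"
    unfolding min_degree_coloring_def card_edges_complete_graph assms(3)[symmetric] d_eq image
    using deg by (simp add: verts_complete_graph)
  then have "rainbow_degree n (complete_graph q) = \<infinity>"
    unfolding rainbow_degree_def using no_copy by auto
  ultimately show ?thesis using no_copy by (intro conjI exI[of _ "{..<l}"] exI[of _ c]) auto
qed

end
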